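(* There exist a constant $R>0$ and, for each dimension $d\ge 1$, a compact convex set $\mathcal W_d\subset\mathbb R^d$ contained in the Euclidean ball of radius $R$ about the origin, a loss function $f_d(w;z)$, convex in $w\in\mathcal W_d$ for every $z\in\mathbb R^d$, and a probability distribution $\mathcal D_d$ on $\mathbb R^d$, such that for every fixed $n\ge 1$: when $S_n$ consists of $n$ i.i.d. samples from $\mathcal D_d$, the minimizer $w_n^*(S_n)$ of the empirical loss over $\mathcal W_d$ is unique with probability tending to $1$ as $d\to\infty$, and $$\lim_{d\to+\infty}G(f_d,\mathcal D_d)\ge\frac18 .$$ Moreover, $\sup_{w\in\mathcal W_d}\|\nabla_w f_d(w;z)\|\le 2$ and $f_d(\cdot;z)$ is $1$-smooth for every $d$ and $z$.
   Context: $\|\cdot\|$ is the Euclidean norm. A differentiable function of $w$ is $1$-smooth if its gradient is $1$-Lipschitz. For a data set $S_n=\{z_1,\dots,z_n\}$ of i.i.d. samples from $\mathcal D_d$, the empirical loss is $\ell(w,S_n)=\frac1n\sum_{i=1}^n f_d(w;z_i)$, and $w_n^*(S_n)\in\arg\min_{w\in\mathcal W_d}\ell(w,S_n)$. The generalization error at optimality (for sample size $n$) is $$G(f_d,\mathcal D_d)=E_{z\sim\mathcal D_d,\,S_n\sim\mathcal D_d}\big[f_d(w_n^*(S_n);z)-\ell(w_n^*(S_n),S_n)\big],$$ with $z$ independent of $S_n$; when the minimizer $w_n^*(S_n)$ is not unique, $G(f_d,\mathcal D_d)$ is the worst (largest) generalization error over all possible choices of $w_n^*(S_n)$. *)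

theory Defs
  imports "HOL-Probability.Probability"
begin

text \<open>
  The dimension varies inside the statement, so the space of real vectors of dimension \<open>d\<close> is
  rendered as the set of functions on the index set \<open>{..<d}\<close>, extended by \<open>undefined\<close>.  This is
  the carrier of both the product topology and the product Borel measure space over \<open>{..<d}\<close>,
  which are the Euclidean topology and the Borel sigma-algebra.
\<close>

type_synonym vect = "nat \<Rightarrow> real"

definition Rd :: "nat \<Rightarrow> vect set" where
  "Rd d = (\<Pi>\<^sub>E i\<in>{..<d}. UNIV)"

definition top_Rd :: "nat \<Rightarrow> vect topology" where
  "top_Rd d = product_topology (\<lambda>_. euclideanreal) {..<d}"

definition borel_Rd :: "nat \<Rightarrow> vect measure" where
  "borel_Rd d = (\<Pi>\<^sub>M i\<in>{..<d}. borel)"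

definition inner_Rd :: "nat \<Rightarrow> vect \<Rightarrow> vect \<Rightarrow> real" where
  "inner_Rd d x y = (\<Sum>i<d. x i * y i)"

definition norm_Rd :: "nat \<Rightarrow> vect \<Rightarrow> real" where
  "norm_Rd d x = L2_set x {..<d}"

definition diff_Rd :: "nat \<Rightarrow> vect \<Rightarrow> vect \<Rightarrow> vect" where
  "diff_Rd d x y = (\<lambda>i\<in>{..<d}. x i - y i)"

definition conv_comb :: "nat \<Rightarrow> real \<Rightarrow> vect \<Rightarrow> vect \<Rightarrow> vect" where
  "conv_comb d t x y = (\<lambda>i\<in>{..<d}. (1 - t) * x i + t * y i)"

definition convex_Rd :: "nat \<Rightarrow> vect set \<Rightarrow> bool" where
  "convex_Rd d W \<longleftrightarrow> W \<subseteq> Rd d \<and> (\<forall>x\<in>W. \<forall>y\<in>W. \<forall>t\<in>{0..1}. conv_comb d t x y \<in> W)"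

definition convex_on_Rd :: "nat \<Rightarrow> vect set \<Rightarrow> (vect \<Rightarrow> real) \<Rightarrow> bool" where
  "convex_on_Rd d W \<phi> \<longleftrightarrow> convex_Rd d W \<and>
     (\<forall>x\<in>W. \<forall>y\<in>W. \<forall>t\<in>{0..1}. \<phi> (conv_comb d t x y) \<le> (1 - t) * \<phi> x + t * \<phi> y)"

text \<open>Frechet differentiability at \<open>w\<close> with gradient \<open>g\<close>, in the whole space of dimension \<open>d\<close>.\<close>

definition has_gradient :: "nat \<Rightarrow> (vect \<Rightarrow> real) \<Rightarrow> vect \<Rightarrow> vect \<Rightarrow> bool" where
  "has_gradient d \<phi> g w \<longleftrightarrow> g \<in> Rd d \<and>
     (\<forall>\<epsilon>>0. \<exists>\<delta>>0. \<forall>v\<in>Rd d. norm_Rd d (diff_Rd d v w) < \<delta> \<longrightarrow>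
        \<bar>\<phi> v - \<phi> w - inner_Rd d g (diff_Rd d v w)\<bar> \<le> \<epsilon> * norm_Rd d (diff_Rd d v w))"

definition gradient :: "nat \<Rightarrow> (vect \<Rightarrow> real) \<Rightarrow> vect \<Rightarrow> vect" where
  "gradient d \<phi> w = (THE g. has_gradient d \<phi> g w)"

definition smooth_Rd :: "real \<Rightarrow> nat \<Rightarrow> (vect \<Rightarrow> real) \<Rightarrow> bool" where
  "smooth_Rd \<beta> d \<phi> \<longleftrightarrow> (\<forall>w\<in>Rd d. \<exists>g. has_gradient d \<phi> g w) \<and>
     (\<forall>v\<in>Rd d. \<forall>w\<in>Rd d. norm_Rd d (diff_Rd d (gradient d \<phi> v) (gradient d \<phi> w))
        \<le> \<beta> * norm_Rd d (diff_Rd d v w))"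

text \<open>A data set of size \<open>n\<close> is a function \<open>S\<close> with entries \<open>S 0, ..., S (n - 1)\<close>; its law is the
  \<open>n\<close>-fold product of the data distribution.\<close>

definition sample_law :: "nat \<Rightarrow> vect measure \<Rightarrow> (nat \<Rightarrow> vect) measure" where
  "sample_law n D = (\<Pi>\<^sub>M j\<in>{..<n}. D)"

definition emp_loss :: "(vect \<Rightarrow> vect \<Rightarrow> real) \<Rightarrow> nat \<Rightarrow> (nat \<Rightarrow> vect) \<Rightarrow> vect \<Rightarrow> real" where
  "emp_loss f n S w = (\<Sum>j<n. f w (S j)) / real n"

definition emp_minimizer ::
    "vect set \<Rightarrow> (vect \<Rightarrow> vect \<Rightarrow> real) \<Rightarrow> nat \<Rightarrow> (nat \<Rightarrow> vect) \<Rightarrow> vect \<Rightarrow> bool" where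
  "emp_minimizer W f n S w \<longleftrightarrow> is_arg_min (emp_loss f n S) (\<lambda>v. v \<in> W) w"

text \<open>The possible choices of the minimizer as a (measurable) function of the data set.\<close>

definition minimizer_choices ::
    "nat \<Rightarrow> vect set \<Rightarrow> (vect \<Rightarrow> vect \<Rightarrow> real) \<Rightarrow> vect measure \<Rightarrow> nat \<Rightarrow> ((nat \<Rightarrow> vect) \<Rightarrow> vect) set" where
  "minimizer_choices d W f D n =
     {ws \<in> measurable (sample_law n D) (borel_Rd d).
        \<forall>S\<in>space (sample_law n D). emp_minimizer W f n S (ws S)}"

text \<open>The supremum is taken in the extended reals, so that it is negative infinity
  if there is no measurable choice of a minimizer.\<close>

definition gen_error ::
    "nat \<Rightarrow> vect set \<Rightarrow> (vect \<Rightarrow> vect \<Rightarrow> real) \<Rightarrow> vect measure \<Rightarrow> nat \<Rightarrow> ereal" where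
  "gen_error d W f D n =
     (SUP ws \<in> minimizer_choices d W f D n.
        ereal (\<integral>(z, S). f (ws S) z - emp_loss f n S (ws S) \<partial>(D \<Otimes>\<^sub>M sample_law n D)))"

end

theory Submission
  imports Defs "HOL-Library.Discrete_Functions" "HOL-Library.Nat_Bijection"
begin

text \<open>
  The loss \<open>f(w; z) = (1/2) \<Sum>\<^sub>i \<lambda>\<^sub>i(z) w\<^sub>i\<^sup>2 - \<epsilon> \<Sum>\<^sub>i w\<^sub>i\<close> on the unit ball has weights \<open>\<lambda>\<^sub>i(z) \<in> {\<epsilon>, 1}\<close> with
  \<open>\<epsilon> = 1 / d\<^sup>2\<close>. A data point is a uniformly random label below \<open>2 m\<close>, and \<open>\<lambda>\<^sub>i(z) = \<epsilon>\<close> iff the label lies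
  in a set \<open>B\<^sub>i\<close> of size \<open>m\<close>, so every weight has mean \<open>(1 + \<epsilon>) / 2\<close>. Since all \<open>m\<close>-element sets of labels
  occur among the \<open>B\<^sub>i\<close> (possible with \<open>m\<close> of order \<open>log d\<close>), any \<open>n \<le> m\<close> samples lie in a common \<open>B\<^sub>k\<close>. In
  coordinate \<open>k\<close> the empirical loss decreases up to \<open>w\<^sub>k = 1\<close>, which forces the empirical minimizer onto the
  unit sphere, while comparison with \<open>w = 0\<close> makes its empirical quadratic part at most \<open>\<epsilon> d = 1 / d\<close>. The linear
  part cancels in the generalization error, which therefore tends to \<open>1/4\<close>. Strict convexity makes
  the minimizer unique for every data set.
\<close>

section \<open>Vectors of dimension \<open>d\<close> and the compact unit ball\<close>

definition unit_ball :: "nat \<Rightarrow> vect set" where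
  "unit_ball d = {w \<in> Rd d. (\<Sum>i<d. (w i)\<^sup>2) \<le> 1}"

text \<open>Only the coefficients \<open>a\<close> will depend on the data, so averaging over data
  stays within this family; the same lemmas then serve the loss at a single point and the empirical
  loss.\<close>

definition quad :: "nat \<Rightarrow> (nat \<Rightarrow> real) \<Rightarrow> real \<Rightarrow> vect \<Rightarrow> real" where
  "quad d a c w = (\<Sum>i<d. a i * (w i)\<^sup>2 / 2 - c * w i)"

lemma norm_Rd_nonneg: "0 \<le> norm_Rd d x"
  by (simp add: norm_Rd_def L2_set_nonneg)

lemma norm_Rd_sq: "(norm_Rd d x)\<^sup>2 = (\<Sum>i<d. (x i)\<^sup>2)"
  by (simp add: norm_Rd_def L2_set_def sum_nonneg)

lemma restrict_in_Rd: "restrict x {..<d} \<in> Rd d"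
  by (simp add: Rd_def)

lemma Rd_eqI: "x \<in> Rd d \<Longrightarrow> y \<in> Rd d \<Longrightarrow> (\<And>i. i < d \<Longrightarrow> x i = y i) \<Longrightarrow> x = y"
  unfolding Rd_def by (rule PiE_ext) auto

lemma unit_ball_Rd: "w \<in> unit_ball d \<Longrightarrow> w \<in> Rd d"
  by (simp add: unit_ball_def)

lemma norm_le_one: "w \<in> unit_ball d \<Longrightarrow> norm_Rd d w \<le> 1"
  by (simp add: norm_Rd_def L2_set_def unit_ball_def)

lemma unit_ball_coord:
  assumes "w \<in> unit_ball d" "i < d"
  shows "\<bar>w i\<bar> \<le> 1"
proof -
  have "(w i)\<^sup>2 \<le> (\<Sum>i<d. (w i)\<^sup>2)"
    using assms(2) by (intro member_le_sum) auto
  also have "\<dots> \<le> 1" using assms(1) by (simp add: unit_ball_def)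
  finally show ?thesis by (simp add: abs_square_le_1)
qed

lemma zero_in_unit_ball: "(\<lambda>i\<in>{..<d}. 0) \<in> unit_ball d"
  by (simp add: unit_ball_def restrict_in_Rd)

text \<open>The ball is a closed subset of the cube with sides \<open>{-1..1}\<close>, which is
  compact by Tychonoff's theorem.\<close>

lemma compactin_unit_ball: "compactin (top_Rd d) (unit_ball d)"
proof (rule closed_compactin)
  show "compactin (top_Rd d) (PiE {..<d} (\<lambda>_. {-1..1}))"
    by (auto simp: top_Rd_def compactin_PiE)
  show "unit_ball d \<subseteq> PiE {..<d} (\<lambda>_. {-1..1})"
  proof
    fix w assume w: "w \<in> unit_ball d"
    then have "w \<in> extensional {..<d}" by (auto simp: unit_ball_def Rd_def PiE_def)
    moreover have "- 1 \<le> w i \<and> w i \<le> 1" if "i < d" for i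
      using unit_ball_coord[OF w that] by linarith
    ultimately show "w \<in> PiE {..<d} (\<lambda>_. {-1..1})" by (auto simp: PiE_def)
  qed
  have "continuous_map (top_Rd d) euclideanreal (\<lambda>w. \<Sum>i<d. (w i)\<^sup>2)"
    unfolding top_Rd_def by (intro continuous_intros continuous_map_product_projection) auto
  from closedin_continuous_map_preimage[OF this, of "{..1}"]
  show "closedin (top_Rd d) (unit_ball d)"
    by (simp add: unit_ball_def top_Rd_def Rd_def)
qed

section \<open>Exact convexity defects and convexity\<close>

lemma square_conv_comb:
  "((1 - t) * x + t * y)\<^sup>2 = (1 - t) * x\<^sup>2 + t * y\<^sup>2 - t * (1 - t) * (x - y)\<^sup>2" for x y t :: real
  by (simp add: power2_eq_square algebra_simps)

text \<open>An identity rather than an inequality: unit weights give convexity of the ball, general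
  weights give convexity of \<open>quad\<close>, and the defect term later gives uniqueness of
  minimizers.\<close>

lemma sum_square_conv_comb:
  "(\<Sum>i<d. a i * (conv_comb d t x y i)\<^sup>2) =
     (1 - t) * (\<Sum>i<d. a i * (x i)\<^sup>2) + t * (\<Sum>i<d. a i * (y i)\<^sup>2)
       - t * (1 - t) * (\<Sum>i<d. a i * (x i - y i)\<^sup>2)"
  unfolding sum_distrib_left sum.distrib[symmetric] sum_subtractf[symmetric]
proof (rule sum.cong)
  fix i assume "i \<in> {..<d}"
  then have "(conv_comb d t x y i)\<^sup>2 = (1 - t) * (x i)\<^sup>2 + t * (y i)\<^sup>2 - t * (1 - t) * (x i - y i)\<^sup>2"
    by (simp add: conv_comb_def square_conv_comb)
  then show "a i * (conv_comb d t x y i)\<^sup>2 =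
      (1 - t) * (a i * (x i)\<^sup>2) + t * (a i * (y i)\<^sup>2) - t * (1 - t) * (a i * (x i - y i)\<^sup>2)"
    by (simp only:) (simp add: right_diff_distrib distrib_left mult.left_commute)
qed simp

lemma quad_alt: "quad d a c w = (\<Sum>i<d. a i * (w i)\<^sup>2) / 2 - c * (\<Sum>i<d. w i)"
  by (simp add: quad_def sum_subtractf sum_distrib_left sum_divide_distrib)

lemma quad_conv_comb:
  "quad d a c (conv_comb d t x y) = (1 - t) * quad d a c x + t * quad d a c y
     - t * (1 - t) * (\<Sum>i<d. a i * (x i - y i)\<^sup>2) / 2"
proof -
  have "(\<Sum>i<d. conv_comb d t x y i) = (1 - t) * (\<Sum>i<d. x i) + t * (\<Sum>i<d. y i)"
    by (simp add: conv_comb_def sum.distrib sum_distrib_left)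
  then show ?thesis
    unfolding quad_alt sum_square_conv_comb
    by (simp only:) (simp add: algebra_simps add_divide_distrib diff_divide_distrib)
qed

lemma convex_unit_ball: "convex_Rd d (unit_ball d)"
proof -
  have "conv_comb d t x y \<in> unit_ball d"
    if "x \<in> unit_ball d" "y \<in> unit_ball d" "t \<in> {0..1}" for x y t
  proof -
    have "0 \<le> t * (1 - t) * (\<Sum>i<d. (x i - y i)\<^sup>2)"
      using that by (intro mult_nonneg_nonneg sum_nonneg) auto
    moreover have "(1 - t) * (\<Sum>i<d. (x i)\<^sup>2) + t * (\<Sum>i<d. (y i)\<^sup>2) \<le> (1 - t) * 1 + t * 1"
      using that by (intro add_mono mult_left_mono) (auto simp: unit_ball_def)
    ultimately have "(\<Sum>i<d. (conv_comb d t x y i)\<^sup>2) \<le> 1"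
      using sum_square_conv_comb[where a = "\<lambda>_. 1" and d = d and t = t and x = x and y = y] by simp
    then show ?thesis by (simp add: unit_ball_def conv_comb_def Rd_def)
  qed
  then show ?thesis by (auto simp: convex_Rd_def unit_ball_def)
qed

lemma convex_on_quad:
  assumes "\<And>i. i < d \<Longrightarrow> 0 \<le> a i"
  shows "convex_on_Rd d (unit_ball d) (quad d a c)"
proof -
  have "0 \<le> t * (1 - t) * (\<Sum>i<d. a i * (x i - y i)\<^sup>2) / 2" if "t \<in> {0..1}" for t x y
    using that assms by (intro divide_nonneg_nonneg mult_nonneg_nonneg sum_nonneg) auto
  then show ?thesis by (simp add: convex_on_Rd_def convex_unit_ball quad_conv_comb)
qed

section \<open>Gradients, their norm and smoothness\<close>

text \<open>Justifies the definite description in \<open>gradient\<close>. For a step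
  \<open>t * (g - h)\<close> the two linear approximations differ by \<open>t * s^2\<close>, where
  \<open>s\<close> is the norm of \<open>g - h\<close>, but each is within
  \<open>t * s^2 / 4\<close> of the same increment of the function.\<close>

lemma has_gradient_unique:
  assumes g: "has_gradient d \<phi> g w" and h: "has_gradient d \<phi> h w" and w: "w \<in> Rd d"
  shows "g = h"
proof (rule ccontr)
  assume "g \<noteq> h"
  have gh: "g \<in> Rd d" "h \<in> Rd d" using g h by (auto simp: has_gradient_def)
  with \<open>g \<noteq> h\<close> obtain i where i: "i < d" "g i \<noteq> h i" using Rd_eqI by blast
  define s where "s = norm_Rd d (diff_Rd d g h)"
  have s2: "s\<^sup>2 = (\<Sum>i<d. (g i - h i)\<^sup>2)" by (simp add: s_def norm_Rd_sq diff_Rd_def)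
  have "0 < (\<Sum>i<d. (g i - h i)\<^sup>2)"
    using i by (intro sum_pos2[of _ i]) auto
  then have s: "0 < s" using s2 norm_Rd_nonneg[of d "diff_Rd d g h"] s_def by (cases "s = 0") auto
  obtain \<delta>1 where d1: "\<delta>1 > 0" "\<And>v. v \<in> Rd d \<Longrightarrow> norm_Rd d (diff_Rd d v w) < \<delta>1 \<Longrightarrow>
        \<bar>\<phi> v - \<phi> w - inner_Rd d g (diff_Rd d v w)\<bar> \<le> s / 4 * norm_Rd d (diff_Rd d v w)"
    using g[unfolded has_gradient_def, THEN conjunct2, rule_format, of "s / 4"] s by auto
  obtain \<delta>2 where d2: "\<delta>2 > 0" "\<And>v. v \<in> Rd d \<Longrightarrow> norm_Rd d (diff_Rd d v w) < \<delta>2 \<Longrightarrow>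
        \<bar>\<phi> v - \<phi> w - inner_Rd d h (diff_Rd d v w)\<bar> \<le> s / 4 * norm_Rd d (diff_Rd d v w)"
    using h[unfolded has_gradient_def, THEN conjunct2, rule_format, of "s / 4"] s by auto
  \<comment> \<open>The displacement then has norm \<open>t * s\<close>, half of the smaller radius,
    so both error bounds apply.\<close>
  define t where "t = min \<delta>1 \<delta>2 / (2 * s)"
  have t: "t > 0" using s d1 d2 by (simp add: t_def)
  define v where "v = (\<lambda>i\<in>{..<d}. w i + t * (g i - h i))"
  have v: "v \<in> Rd d" by (simp add: v_def restrict_in_Rd)
  have "(norm_Rd d (diff_Rd d v w))\<^sup>2 = (t * s)\<^sup>2"
    by (simp add: norm_Rd_sq diff_Rd_def v_def power_mult_distrib s2 sum_distrib_left)
  then have nv: "norm_Rd d (diff_Rd d v w) = t * s"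
    using norm_Rd_nonneg t s by (simp add: power2_eq_iff_nonneg)
  have "t * s = min \<delta>1 \<delta>2 / 2" using s by (simp add: t_def)
  then have lt: "t * s < \<delta>1" "t * s < \<delta>2" using d1(1) d2(1) by linarith+
  have "inner_Rd d g (diff_Rd d v w) - inner_Rd d h (diff_Rd d v w) = t * s\<^sup>2"
    unfolding inner_Rd_def s2 sum_subtractf[symmetric] sum_distrib_left
    by (rule sum.cong) (simp_all add: diff_Rd_def v_def power2_eq_square algebra_simps)
  moreover have "\<bar>\<phi> v - \<phi> w - inner_Rd d g (diff_Rd d v w)\<bar> \<le> s / 4 * (t * s)"
    using d1(2)[OF v] lt nv by simp
  moreover have "\<bar>\<phi> v - \<phi> w - inner_Rd d h (diff_Rd d v w)\<bar> \<le> s / 4 * (t * s)"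
    using d2(2)[OF v] lt nv by simp
  moreover have "s / 4 * (t * s) = t * s\<^sup>2 / 4" by (simp add: power2_eq_square)
  moreover have "t * s\<^sup>2 > 0" using t s by simp
  ultimately show False by linarith
qed

lemma gradient_eqI: "has_gradient d \<phi> g w \<Longrightarrow> w \<in> Rd d \<Longrightarrow> gradient d \<phi> w = g"
  unfolding gradient_def by (rule the_equality) (assumption, erule has_gradient_unique)

lemma has_gradient_quad:
  assumes a: "\<And>i. i < d \<Longrightarrow> 0 \<le> a i \<and> a i \<le> 1"
  shows "has_gradient d (quad d a c) (\<lambda>i\<in>{..<d}. a i * w i - c) w"
  unfolding has_gradient_def
proof (intro conjI allI impI restrict_in_Rd)
  fix \<epsilon> :: real assume "\<epsilon> > 0"
  show "\<exists>\<delta>>0. \<forall>v\<in>Rd d. norm_Rd d (diff_Rd d v w) < \<delta> \<longrightarrow>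
     \<bar>quad d a c v - quad d a c w - inner_Rd d (\<lambda>i\<in>{..<d}. a i * w i - c) (diff_Rd d v w)\<bar>
       \<le> \<epsilon> * norm_Rd d (diff_Rd d v w)"
  \<comment> \<open>The remainder is exactly half of a weighted sum of squares, hence at most half
    the squared distance, so the radius can be the error factor itself.\<close>
  proof (intro exI[of _ \<epsilon>] conjI ballI impI \<open>\<epsilon> > 0\<close>)
    fix v assume lt: "norm_Rd d (diff_Rd d v w) < \<epsilon>"
    let ?N = "norm_Rd d (diff_Rd d v w)"
    have "quad d a c v - quad d a c w - inner_Rd d (\<lambda>i\<in>{..<d}. a i * w i - c) (diff_Rd d v w)
        = (\<Sum>i<d. a i * (v i - w i)\<^sup>2) / 2"
      unfolding quad_def inner_Rd_def sum_subtractf[symmetric] sum_divide_distrib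
    proof (rule sum.cong)
      have *: "a * y\<^sup>2 / 2 - c * y - (a * x\<^sup>2 / 2 - c * x) - (a * x - c) * (y - x) = a * (y - x)\<^sup>2 / 2"
        for a x y :: real by (simp add: power2_eq_square field_simps)
      fix i assume "i \<in> {..<d}"
      then show "a i * (v i)\<^sup>2 / 2 - c * v i - (a i * (w i)\<^sup>2 / 2 - c * w i)
          - (\<lambda>i\<in>{..<d}. a i * w i - c) i * diff_Rd d v w i = a i * (v i - w i)\<^sup>2 / 2"
        using *[of "a i" "v i" "w i"] by (simp add: diff_Rd_def)
    qed simp
    moreover have "0 \<le> (\<Sum>i<d. a i * (v i - w i)\<^sup>2)"
      using a by (intro sum_nonneg) auto
    moreover have "(\<Sum>i<d. a i * (v i - w i)\<^sup>2) \<le> (\<Sum>i<d. (v i - w i)\<^sup>2)"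
      using a by (intro sum_mono mult_left_le_one_le) auto
    moreover have "(\<Sum>i<d. (v i - w i)\<^sup>2) = ?N * ?N"
    proof -
      have "?N * ?N = ?N\<^sup>2" by (rule power2_eq_square[symmetric])
      also have "\<dots> = (\<Sum>i<d. (v i - w i)\<^sup>2)" unfolding norm_Rd_sq by (simp add: diff_Rd_def)
      finally show ?thesis by (rule sym)
    qed
    moreover have "?N * ?N \<le> \<epsilon> * ?N"
      using lt norm_Rd_nonneg by (intro mult_right_mono) auto
    ultimately show "\<bar>quad d a c v - quad d a c w
        - inner_Rd d (\<lambda>i\<in>{..<d}. a i * w i - c) (diff_Rd d v w)\<bar> \<le> \<epsilon> * ?N"
      by linarith
  qed
qed

lemma gradient_quad:
  assumes "\<And>i. i < d \<Longrightarrow> 0 \<le> a i \<and> a i \<le> 1" "w \<in> Rd d"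
  shows "gradient d (quad d a c) w = (\<lambda>i\<in>{..<d}. a i * w i - c)"
  by (rule gradient_eqI[OF has_gradient_quad]) (use assms in auto)

text \<open>The gradient is an affine map whose linear part is diagonal with entries between 0 and
  1, hence nonexpansive.\<close>

lemma smooth_quad:
  assumes a: "\<And>i. i < d \<Longrightarrow> 0 \<le> a i \<and> a i \<le> 1"
  shows "smooth_Rd 1 d (quad d a c)"
  unfolding smooth_Rd_def
proof (intro conjI ballI)
  fix w show "\<exists>g. has_gradient d (quad d a c) g w"
    using has_gradient_quad[of d a c w] a by blast
next
  fix v w assume v: "v \<in> Rd d" and w: "w \<in> Rd d"
  have "(a i * (v i - w i))\<^sup>2 \<le> (v i - w i)\<^sup>2" if "i < d" for i
    using a[OF that] by (simp add: power_mult_distrib power_le_one mult_left_le_one_le)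
  then have "(\<Sum>i<d. (a i * v i - a i * w i)\<^sup>2) \<le> (\<Sum>i<d. (v i - w i)\<^sup>2)"
    by (intro sum_mono) (simp add: right_diff_distrib)
  then show "norm_Rd d (diff_Rd d (gradient d (quad d a c) v) (gradient d (quad d a c) w))
      \<le> 1 * norm_Rd d (diff_Rd d v w)"
    by (simp add: gradient_quad a v w norm_Rd_def L2_set_def diff_Rd_def)
qed

text \<open>The diagonal part maps the unit ball into itself, and the constant part is bounded by
  its sum norm \<open>d * c\<close>.\<close>

lemma norm_gradient_quad_le:
  assumes a: "\<And>i. i < d \<Longrightarrow> 0 \<le> a i \<and> a i \<le> 1" and c: "0 \<le> c" and w: "w \<in> unit_ball d"
  shows "norm_Rd d (gradient d (quad d a c) w) \<le> 1 + d * c"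
proof -
  have "norm_Rd d (gradient d (quad d a c) w) = L2_set (\<lambda>i. a i * w i + - c) {..<d}"
    using w by (simp add: gradient_quad a unit_ball_Rd norm_Rd_def L2_set_def)
  also have "\<dots> \<le> L2_set (\<lambda>i. a i * w i) {..<d} + L2_set (\<lambda>i. - c) {..<d}"
    by (rule L2_set_triangle_ineq)
  also have "L2_set (\<lambda>i. - c) {..<d} = L2_set (\<lambda>i. c) {..<d}" by (simp add: L2_set_def)
  also have "L2_set (\<lambda>i. c) {..<d} \<le> d * c"
    using L2_set_le_sum[of "{..<d}" "\<lambda>_. c"] c by simp
  also have "L2_set (\<lambda>i. a i * w i) {..<d} \<le> 1"
  proof -
    have "(a i * w i)\<^sup>2 \<le> (w i)\<^sup>2" if "i < d" for i
      using a[OF that] by (simp add: power_mult_distrib power_le_one mult_left_le_one_le)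
    then have "(\<Sum>i<d. (a i * w i)\<^sup>2) \<le> (\<Sum>i<d. (w i)\<^sup>2)" by (intro sum_mono) simp
    then show ?thesis using w by (simp add: L2_set_def unit_ball_def)
  qed
  finally show ?thesis by simp
qed

section \<open>Minimizers of diagonal quadratics on the ball\<close>

text \<open>Existence comes from compactness. For uniqueness, the midpoint of two minimizers would
  have a strictly smaller value unless the defect vanishes, and positive weights then force
  equality.\<close>

lemma quad_ex1_minimizer:
  assumes a: "\<And>i. i < d \<Longrightarrow> 0 < a i"
  shows "\<exists>!w. is_arg_min (quad d a c) (\<lambda>v. v \<in> unit_ball d) w"
proof -
  have "continuous_map (top_Rd d) euclideanreal (quad d a c)"
  proof -
    have "continuous_map (top_Rd d) euclideanreal
        (\<lambda>w. (\<Sum>i<d. a i * (w i)\<^sup>2) * (1 / 2) - c * (\<Sum>i<d. w i))"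
      unfolding top_Rd_def
      by (intro continuous_map_diff continuous_map_real_mult continuous_map_sum
          continuous_map_real_pow continuous_map_product_projection) auto
    then show ?thesis by (simp add: quad_alt[abs_def])
  qed
  from image_compactin[OF compactin_unit_ball this]
  have "compact (quad d a c ` unit_ball d)" by simp
  moreover have "quad d a c ` unit_ball d \<noteq> {}" using zero_in_unit_ball by blast
  ultimately obtain s where "s \<in> quad d a c ` unit_ball d" "\<forall>t\<in>quad d a c ` unit_ball d. s \<le> t"
    using compact_attains_inf by blast
  then obtain w where w: "w \<in> unit_ball d" "\<And>v. v \<in> unit_ball d \<Longrightarrow> quad d a c w \<le> quad d a c v"
    by auto
  show ?thesis
  proof (rule ex1I[of _ w])
    show "is_arg_min (quad d a c) (\<lambda>v. v \<in> unit_ball d) w"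
      using w by (auto simp: is_arg_min_linorder)
    fix v assume "is_arg_min (quad d a c) (\<lambda>v. v \<in> unit_ball d) v"
    then have v: "v \<in> unit_ball d" "quad d a c v \<le> quad d a c w"
      using w by (auto simp: is_arg_min_linorder)
    have "conv_comb d (1/2) v w \<in> unit_ball d"
      using convex_unit_ball v w by (auto simp: convex_Rd_def)
    \<comment> \<open>The factor 1/8 is \<open>t * (1 - t) / 2\<close> at
      \<open>t = 1/2\<close>.\<close>
    from w(2)[OF this] have "quad d a c w \<le> quad d a c v / 2 + quad d a c w / 2
        - (\<Sum>i<d. a i * (v i - w i)\<^sup>2) / 8"
      unfolding quad_conv_comb by simp
    with v(2) have "(\<Sum>i<d. a i * (v i - w i)\<^sup>2) \<le> 0" by linarith
    moreover have nn: "0 \<le> a i * (v i - w i)\<^sup>2" if "i \<in> {..<d}" for i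
      using a that by (auto simp: less_imp_le)
    ultimately have "(\<Sum>i<d. a i * (v i - w i)\<^sup>2) = 0"
      using sum_nonneg[of "{..<d}" "\<lambda>i. a i * (v i - w i)\<^sup>2", OF nn] by linarith
    then have z: "\<forall>i\<in>{..<d}. a i * (v i - w i)\<^sup>2 = 0"
      by (subst (asm) sum_nonneg_eq_0_iff) (use nn in simp_all)
    have "v i = w i" if "i < d" for i
      using z[rule_format, of i] a[OF that] that by simp
    then show "v = w" using v w unit_ball_Rd by (intro Rd_eqI[of _ d]) auto
  qed
qed

text \<open>In coordinate \<open>k\<close> the loss is \<open>c (w k\<^sup>2 / 2 - w k)\<close>, which still decreases up to
  \<open>w k = 1\<close>.\<close>

lemma quad_minimizer_on_sphere:
  assumes min: "is_arg_min (quad d a c) (\<lambda>v. v \<in> unit_ball d) w"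
    and k: "k < d" "a k = c" "0 < c"
  shows "(\<Sum>i<d. (w i)\<^sup>2) = 1"
proof (rule ccontr)
  assume neq: "(\<Sum>i<d. (w i)\<^sup>2) \<noteq> 1"
  have w: "w \<in> unit_ball d" and le: "\<And>v. v \<in> unit_ball d \<Longrightarrow> quad d a c w \<le> quad d a c v"
    using min by (auto simp: is_arg_min_linorder)
  define r where "r = (\<Sum>i\<in>{..<d} - {k}. (w i)\<^sup>2)"
  have r0: "0 \<le> r" by (simp add: r_def sum_nonneg)
  have "(\<Sum>i<d. (w i)\<^sup>2) = (w k)\<^sup>2 + r"
    using k by (simp add: r_def sum.remove)
  then have r1: "(w k)\<^sup>2 + r < 1" using neq w by (simp add: unit_ball_def)
  \<comment> \<open>With the other coordinates kept, \<open>y\<close> is the nonnegative value of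
    coordinate \<open>k\<close> that puts the point on the sphere.\<close>
  define y where "y = sqrt (1 - r)"
  have wy: "w k < y"
    unfolding y_def using r1 by (intro real_less_rsqrt) simp
  have y2: "y\<^sup>2 = 1 - r" using r1 by (simp add: y_def) (smt (verit) zero_le_power2)
  have y1: "y \<le> 1" using r0 by (simp add: y_def)
  define v where "v = w(k := y)"
  have rv: "r = (\<Sum>i\<in>{..<d} - {k}. (v i)\<^sup>2)" unfolding r_def v_def by (rule sum.cong) auto
  have "(\<Sum>i<d. (v i)\<^sup>2) = (v k)\<^sup>2 + r"
    unfolding rv using k by (simp add: sum.remove)
  then have "v \<in> unit_ball d"
    using w k y2 by (auto simp: unit_ball_def v_def Rd_def PiE_def extensional_def)
  from le[OF this] have "quad d a c w \<le> quad d a c v" .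
  moreover have "quad d a c v - quad d a c w = c * (y\<^sup>2 / 2 - y) - c * ((w k)\<^sup>2 / 2 - w k)"
  proof -
    have "(\<Sum>i\<in>{..<d} - {k}. a i * (v i)\<^sup>2 / 2 - c * v i) = (\<Sum>i\<in>{..<d} - {k}. a i * (w i)\<^sup>2 / 2 - c * w i)"
      by (rule sum.cong) (auto simp: v_def)
    then show ?thesis
      using k by (simp add: quad_def sum.remove[of "{..<d}" k] v_def algebra_simps)
  qed
  \<comment> \<open>The factorization shows the sign: \<open>w k < y\<close> and
    \<open>y <= 1\<close> make the last factor negative.\<close>
  moreover have "c * (y\<^sup>2 / 2 - y) - c * ((w k)\<^sup>2 / 2 - w k) = c * ((y - w k) * ((y + w k) / 2 - 1))"
    by (simp add: power2_eq_square field_simps)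
  moreover have "c * ((y - w k) * ((y + w k) / 2 - 1)) < 0"
    using k(3) wy y1 by (intro mult_pos_neg) auto
  ultimately show False by linarith
qed

text \<open>Comparison with the origin, where the value is 0: the quadratic part cannot exceed the
  linear gain, which is at most \<open>c * d\<close> on the ball.\<close>

lemma quad_minimizer_small:
  assumes min: "is_arg_min (quad d a c) (\<lambda>v. v \<in> unit_ball d) w" and c: "0 \<le> c"
  shows "(\<Sum>i<d. a i * (w i)\<^sup>2) / 2 \<le> c * d"
proof -
  have w: "w \<in> unit_ball d" and le: "\<And>v. v \<in> unit_ball d \<Longrightarrow> quad d a c w \<le> quad d a c v"
    using min by (auto simp: is_arg_min_linorder)
  have "(\<Sum>i<d. w i) \<le> (\<Sum>i<d. 1)"
  proof (rule sum_mono)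
    fix i assume "i \<in> {..<d}"
    then show "w i \<le> 1" using unit_ball_coord[OF w, of i] by simp
  qed
  then have "c * (\<Sum>i<d. w i) \<le> c * d" using c by (intro mult_left_mono) auto
  moreover have "quad d a c w \<le> 0"
    using le[OF zero_in_unit_ball] by (simp add: quad_alt)
  ultimately show ?thesis by (simp add: quad_alt)
qed

section \<open>Label sets, weights and the data distribution\<close>

text \<open>Half the binary logarithm tends to infinity, yet keeps \<open>4 ^ half_size d\<close>
  within \<open>d\<close> once \<open>4 <= d\<close>. The maximum with 1 keeps the set of labels
  nonempty in small dimensions.\<close>

definition half_size :: "nat \<Rightarrow> nat" where
  "half_size d = max 1 (floor_log d div 2)"

text \<open>As \<open>k\<close> ranges over \<open>{..<4 ^ m}\<close>, every \<open>m\<close>-element subset of \<open>{..<2 * m}\<close> occurs.\<close>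

definition half_set :: "nat \<Rightarrow> nat \<Rightarrow> nat set" where
  "half_set m k =
     (if set_decode k \<subseteq> {..<2 * m} \<and> card (set_decode k) = m then set_decode k else {..<m})"

text \<open>Serves both as the small weight and as the coefficient of the linear term, so that a
  coordinate with only small weights has its free minimum at 1. The square makes
  \<open>d * slope d\<close> vanish in the limit.\<close>

definition slope :: "nat \<Rightarrow> real" where
  "slope d = 1 / (real d)\<^sup>2"

definition weight :: "nat \<Rightarrow> nat \<Rightarrow> nat \<Rightarrow> real" where
  "weight d i b = (if b \<in> half_set (half_size d) i then slope d else 1)"

text \<open>A data point carries its label in coordinate \<open>0\<close>. Reducing modulo \<open>2 * half_size d\<close> makes the
  overfitting argument valid for every data set, not merely for almost every one.\<close>

definition label :: "nat \<Rightarrow> vect \<Rightarrow> nat" where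
  "label d z = nat \<lfloor>z 0\<rfloor> mod (2 * half_size d)"

definition loss :: "nat \<Rightarrow> vect \<Rightarrow> vect \<Rightarrow> real" where
  "loss d w z = quad d (\<lambda>i. weight d i (label d z)) (slope d) w"

definition data_law :: "nat \<Rightarrow> vect measure" where
  "data_law d = distr (measure_pmf (pmf_of_set {..<2 * half_size d})) (borel_Rd d)
     (\<lambda>b. \<lambda>i\<in>{..<d}. real b)"

definition avg_weight :: "nat \<Rightarrow> nat \<Rightarrow> (nat \<Rightarrow> vect) \<Rightarrow> nat \<Rightarrow> real" where
  "avg_weight d n S i = (\<Sum>j<n. weight d i (label d (S j))) / real n"

lemma half_size_pos: "0 < half_size d"
  by (simp add: half_size_def)

lemma half_set_subset: "half_set m k \<subseteq> {..<2 * m}"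
  by (auto simp: half_set_def)

text \<open>The fallback \<open>{..<m}\<close> ensures this for every index, including those that do
  not encode a suitable set; this makes the mean weight the same in all coordinates.\<close>

lemma card_half_set: "card (half_set m k) = m"
  by (simp add: half_set_def)

text \<open>The index is the binary code of an \<open>m\<close>-element superset of
  \<open>A\<close>. The code of the full set of \<open>2 * m\<close> labels is
  \<open>4 ^ m - 1\<close>, and no subset has a larger one.\<close>

lemma half_set_covers:
  assumes A: "A \<subseteq> {..<2 * m}" "card A \<le> m"
  shows "\<exists>k<4 ^ m. A \<subseteq> half_set m k"
proof -
  obtain X where X: "A \<subseteq> X" "X \<subseteq> {..<2 * m}" "card X = m"
    using exists_subset_between[of A m "{..<2 * m}"] A by auto
  then have fin: "finite X" by (meson finite_lessThan finite_subset)
  have "set_encode X \<le> (\<Sum>i<2 * m. 2 ^ i)"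
    unfolding set_encode_def using X by (intro sum_mono2) auto
  also have "\<dots> = 4 ^ m - 1"
    by (simp add: sum_power2 lessThan_atLeast0 power_mult)
  finally have "set_encode X < 4 ^ m"
    using zero_less_power[of "4::nat" m] by linarith
  then show ?thesis
    using X fin by (intro exI[of _ "set_encode X"]) (simp add: half_set_def)
qed

text \<open>There are enough coordinates for all codes. From \<open>4 <= d\<close> on,
  \<open>floor_log d div 2\<close> is at least 1, so the maximum in \<open>half_size\<close> has no
  effect.\<close>

lemma four_power_half_size_le:
  assumes "4 \<le> d" shows "4 ^ half_size d \<le> d"
proof -
  have "floor_log (2 ^ 2) \<le> floor_log d" using assms by (intro floor_log_le_iff) simp
  then have "2 \<le> floor_log d" by (simp only: floor_log_power)
  then have "half_size d = floor_log d div 2" by (simp add: half_size_def max_def)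
  then have "(4::nat) ^ half_size d = 2 ^ (2 * (floor_log d div 2))"
    by (simp add: power_mult)
  also have "\<dots> \<le> 2 ^ floor_log d" by (intro power_increasing) auto
  also have "\<dots> \<le> d" using floor_log_exp2_le[of d] assms by simp
  finally show ?thesis .
qed

lemma half_size_ge:
  assumes "4 ^ n \<le> d" shows "n \<le> half_size d"
proof -
  have "2 ^ (2 * n) \<le> d" using assms by (simp add: power_mult)
  from floor_log_le_iff[OF this] show ?thesis by (simp add: half_size_def)
qed

lemma slope_pos: "1 \<le> d \<Longrightarrow> 0 < slope d"
  by (simp add: slope_def)

lemma slope_le_one: "slope d \<le> 1"
  by (cases "d = 0") (simp_all add: slope_def)

lemma dim_times_slope: "real d * slope d = 1 / d"
  by (simp add: slope_def power2_eq_square)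

lemma weight_bounds:
  assumes "1 \<le> d" shows "0 < weight d i b" "weight d i b \<le> 1"
  using slope_pos[OF assms] slope_le_one by (auto simp: weight_def)

section \<open>The empirical loss and its overfitting minimizer\<close>

text \<open>The linear term is the same for every sample, so averaging affects only the
  weights.\<close>

lemma emp_loss_loss:
  assumes "1 \<le> n"
  shows "emp_loss (loss d) n S = quad d (avg_weight d n S) (slope d)"
proof
  fix w
  have "(\<Sum>j<n. loss d w (S j))
      = (\<Sum>i<d. (\<Sum>j<n. weight d i (label d (S j))) * (w i)\<^sup>2) / 2 - n * (slope d * (\<Sum>i<d. w i))"
    unfolding loss_def quad_alt sum_distrib_right
    by (subst sum.swap) (simp add: sum_subtractf sum_divide_distrib)
  moreover have "(\<Sum>i<d. avg_weight d n S i * (w i)\<^sup>2)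
      = (\<Sum>i<d. (\<Sum>j<n. weight d i (label d (S j))) * (w i)\<^sup>2) / n"
    unfolding avg_weight_def sum_divide_distrib[where A = "{..<d}"] by simp
  ultimately show "emp_loss (loss d) n S w = quad d (avg_weight d n S) (slope d) w"
    using assms by (simp add: emp_loss_def quad_alt diff_divide_distrib)
qed

lemma avg_weight_bounds:
  assumes "1 \<le> d" "1 \<le> n"
  shows "0 < avg_weight d n S i" "avg_weight d n S i \<le> 1"
proof -
  have "0 < (\<Sum>j<n. weight d i (label d (S j)))"
    using assms weight_bounds by (intro sum_pos) (auto simp: lessThan_empty_iff)
  then show "0 < avg_weight d n S i" using assms by (simp add: avg_weight_def)
  have "(\<Sum>j<n. weight d i (label d (S j))) \<le> (\<Sum>j<n. 1)"
    using assms weight_bounds by (intro sum_mono) auto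
  then show "avg_weight d n S i \<le> 1" using assms by (simp add: avg_weight_def)
qed

lemma loss_diff_emp_loss:
  assumes "1 \<le> n"
  shows "loss d w z - emp_loss (loss d) n S w
    = (\<Sum>i<d. (weight d i (label d z) - avg_weight d n S i) * (w i)\<^sup>2) / 2"
  by (simp add: emp_loss_loss[OF assms] loss_def quad_alt sum_subtractf left_diff_distrib)

lemma ex1_emp_minimizer:
  assumes "1 \<le> d" "1 \<le> n"
  shows "\<exists>!w. emp_minimizer (unit_ball d) (loss d) n S w"
  unfolding emp_minimizer_def emp_loss_loss[OF assms(2)]
  by (rule quad_ex1_minimizer) (rule avg_weight_bounds[OF assms])

text \<open>The samples carry at most \<open>n\<close> distinct labels, so one coordinate
  \<open>k < d\<close> has a label set containing them all. Its average weight is then exactly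
  \<open>slope d\<close>, as the sphere argument requires.\<close>

lemma emp_minimizer_overfits:
  assumes d: "4 \<le> d" "n \<le> half_size d" and n: "1 \<le> n"
    and w: "emp_minimizer (unit_ball d) (loss d) n S w"
  shows "(\<Sum>i<d. (w i)\<^sup>2) = 1" and "(\<Sum>i<d. avg_weight d n S i * (w i)\<^sup>2) / 2 \<le> 1 / d"
proof -
  let ?A = "(\<lambda>j. label d (S j)) ` {..<n}"
  have "card ?A \<le> half_size d"
    using card_image_le[of "{..<n}" "\<lambda>j. label d (S j)"] d by simp
  moreover have "?A \<subseteq> {..<2 * half_size d}"
    using half_size_pos by (auto simp: label_def)
  ultimately obtain k where k: "k < 4 ^ half_size d" "?A \<subseteq> half_set (half_size d) k"
    using half_set_covers by meson
  have kd: "k < d" using k(1) four_power_half_size_le[OF d(1)] by linarith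
  have "avg_weight d n S k = (\<Sum>j<n. slope d) / n"
    unfolding avg_weight_def weight_def using k(2)
    by (intro arg_cong2[where f = "(/)"] sum.cong) auto
  then have ak: "avg_weight d n S k = slope d" using n by simp
  have min: "is_arg_min (quad d (avg_weight d n S) (slope d)) (\<lambda>v. v \<in> unit_ball d) w"
    using w by (simp add: emp_minimizer_def emp_loss_loss[OF n])
  have pos: "0 < slope d" using d by (intro slope_pos) simp
  show "(\<Sum>i<d. (w i)\<^sup>2) = 1"
    by (rule quad_minimizer_on_sphere[OF min kd ak pos])
  show "(\<Sum>i<d. avg_weight d n S i * (w i)\<^sup>2) / 2 \<le> 1 / d"
    using quad_minimizer_small[OF min] pos dim_times_slope[of d] by (simp add: mult.commute)
qed

section \<open>Measurability and expectations under the data distribution\<close>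

lemma space_borel_Rd: "space (borel_Rd d) = Rd d"
  by (simp add: borel_Rd_def Rd_def space_PiM)

lemma sets_data_law [measurable_cong]: "sets (data_law d) = sets (borel_Rd d)"
  by (simp add: data_law_def)

lemma measurable_data_point:
  "(\<lambda>b. \<lambda>i\<in>{..<d}. real b) \<in> measure_pmf p \<rightarrow>\<^sub>M borel_Rd d"
  by (simp add: measurable_def space_borel_Rd restrict_in_Rd)

lemma prob_space_data_law: "prob_space (data_law d)"
  unfolding data_law_def by (rule measure_pmf.prob_space_distr[OF measurable_data_point])

lemma prob_space_sample_law: "prob_space (sample_law n (data_law d))"
  unfolding sample_law_def by (intro prob_space_PiM prob_space_data_law)

lemma measurable_coord [measurable]: "i < d \<Longrightarrow> (\<lambda>z. z i) \<in> borel_measurable (borel_Rd d)"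
  unfolding borel_Rd_def by (rule measurable_component_singleton) simp

lemma measurable_label:
  assumes "1 \<le> d" shows "label d \<in> borel_Rd d \<rightarrow>\<^sub>M count_space UNIV"
proof -
  have [measurable]: "(\<lambda>z. z 0) \<in> borel_measurable (borel_Rd d)"
    using assms by (intro measurable_coord) simp
  show ?thesis unfolding label_def by measurable
qed

lemma measurable_label_comp:
  fixes g :: "nat \<Rightarrow> real"
  assumes "1 \<le> d" shows "(\<lambda>z. g (label d z)) \<in> borel_measurable (borel_Rd d)"
  by (rule measurable_compose[OF measurable_label[OF assms]]) simp

lemma measurable_sample:
  assumes "j < n" shows "(\<lambda>S. S j) \<in> sample_law n (data_law d) \<rightarrow>\<^sub>M borel_Rd d"
proof -
  have "(\<lambda>S. S j) \<in> sample_law n (data_law d) \<rightarrow>\<^sub>M data_law d"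
    unfolding sample_law_def using assms by (intro measurable_component_singleton) simp
  then show ?thesis by (simp add: measurable_cong_sets[OF refl sets_data_law])
qed

lemma measurable_loss:
  assumes "1 \<le> d"
  shows "(\<lambda>(w, z). loss d w z) \<in> borel_measurable (borel_Rd d \<Otimes>\<^sub>M borel_Rd d)"
proof -
  have "(\<lambda>x. fst x i) \<in> borel_measurable (borel_Rd d \<Otimes>\<^sub>M borel_Rd d)" if "i < d" for i
    by (rule measurable_compose[OF measurable_fst measurable_coord[OF that]])
  moreover have "(\<lambda>x. weight d i (label d (snd x)))
      \<in> borel_measurable (borel_Rd d \<Otimes>\<^sub>M borel_Rd d)" for i
    by (rule measurable_compose[OF measurable_snd measurable_label_comp[OF assms]])
  ultimately show ?thesis
    unfolding loss_def quad_def split_beta'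
    by (intro borel_measurable_sum borel_measurable_diff borel_measurable_times
        borel_measurable_divide borel_measurable_const borel_measurable_power) auto
qed

lemma integral_data_law:
  fixes g :: "nat \<Rightarrow> real"
  assumes "1 \<le> d"
  shows "(\<integral>z. g (label d z) \<partial>data_law d)
    = (\<Sum>b<2 * half_size d. g b) / real (2 * half_size d)"
proof -
  have ne: "{..<2 * half_size d} \<noteq> {}"
    using half_size_pos[of d] by (simp add: lessThan_empty_iff)
  have "(\<integral>z. g (label d z) \<partial>data_law d)
      = (\<integral>b. g (label d (\<lambda>i\<in>{..<d}. real b)) \<partial>measure_pmf (pmf_of_set {..<2 * half_size d}))"
    unfolding data_law_def by (rule integral_distr[OF measurable_data_point measurable_label_comp[OF assms]])
  also have "\<dots> = (\<Sum>b<2 * half_size d. g (label d (\<lambda>i\<in>{..<d}. real b))) / real (2 * half_size d)"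
    using ne by (simp add: integral_pmf_of_set)
  \<comment> \<open>On labels in this range the reduction modulo \<open>2 * half_size d\<close> in
    \<open>label\<close> is the identity.\<close>
  also have "(\<Sum>b<2 * half_size d. g (label d (\<lambda>i\<in>{..<d}. real b))) = (\<Sum>b<2 * half_size d. g b)"
    using assms by (intro sum.cong) (auto simp: label_def)
  finally show ?thesis .
qed

text \<open>Exactly half of the labels give the small weight, whatever \<open>i\<close> is. Hence
  the expected quadratic part depends on \<open>w\<close> only through its norm.\<close>

lemma integral_weight:
  assumes "1 \<le> d"
  shows "(\<integral>z. weight d i (label d z) \<partial>data_law d) = (1 + slope d) / 2"
proof -
  let ?m = "half_size d" and ?B = "half_set (half_size d) i"
  have B: "{..<2 * ?m} \<inter> ?B = ?B" "card ({..<2 * ?m} - ?B) = ?m"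
    using half_set_subset[of ?m i] card_half_set[of ?m i]
    by (auto simp: card_Diff_subset finite_subset)
  have "(\<Sum>b<2 * ?m. weight d i b) = slope d * ?m + ?m"
    unfolding weight_def sum.If_cases[OF finite_lessThan]
    using B card_half_set[of ?m i] by (simp add: Diff_eq)
  then show ?thesis
    unfolding integral_data_law[OF assms] using half_size_pos[of d] by (simp add: field_simps)
qed

lemma integrable_label:
  fixes g :: "nat \<Rightarrow> real"
  assumes "1 \<le> d" shows "integrable (data_law d) (\<lambda>z. g (label d z))"
proof -
  have ne: "{..<2 * half_size d} \<noteq> {}"
    using half_size_pos[of d] by (simp add: lessThan_empty_iff)
  have "finite (set_pmf (pmf_of_set {..<2 * half_size d}))"
    by (subst set_pmf_of_set[OF ne]) simp_all
  then show ?thesis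
    unfolding data_law_def
    by (subst integrable_distr_eq[OF measurable_data_point measurable_label_comp[OF assms]])
      (rule integrable_measure_pmf_finite)
qed

text \<open>The minimizer depends on the data only through the labels, which take countably many
  values.\<close>

lemma minimizer_choices_nonempty:
  assumes d: "1 \<le> d" and n: "1 \<le> n"
  shows "minimizer_choices d (unit_ball d) (loss d) (data_law d) n \<noteq> {}"
proof -
  define code where "code S = map (\<lambda>j. label d (S j)) [0..<n]" for S
  define pick where "pick xs = (THE w. is_arg_min
      (quad d (\<lambda>i. (\<Sum>j<n. weight d i (xs ! j)) / real n) (slope d)) (\<lambda>v. v \<in> unit_ball d) w)" for xs
  have pick: "emp_minimizer (unit_ball d) (loss d) n S (pick (code S))" for S
  proof -
    have "(\<lambda>i. (\<Sum>j<n. weight d i (code S ! j)) / real n) = avg_weight d n S"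
      by (simp add: code_def avg_weight_def fun_eq_iff)
    then have "pick (code S) = (THE w. emp_minimizer (unit_ball d) (loss d) n S w)"
      by (simp add: pick_def emp_minimizer_def emp_loss_loss[OF n])
    then show ?thesis using theI'[OF ex1_emp_minimizer[OF d n, of S]] by (simp only:)
  qed
  \<comment> \<open>The label lists form a countable set, so it suffices that each fibre is
    measurable; a fibre prescribes finitely many labels.\<close>
  have code: "code \<in> sample_law n (data_law d) \<rightarrow>\<^sub>M count_space (range code)"
    unfolding measurable_count_space_eq2_countable
  proof (intro conjI ballI)
    fix xs assume "xs \<in> range code"
    then have "length xs = n" by (auto simp: code_def)
    then have "code S = xs \<longleftrightarrow> (\<forall>j\<in>{..<n}. label d (S j) = xs ! j)" for S
      by (subst list_eq_iff_nth_eq) (auto simp: code_def)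
    then have "code -` {xs} \<inter> space (sample_law n (data_law d))
        = {S \<in> space (sample_law n (data_law d)). \<forall>j\<in>{..<n}. label d (S j) = xs ! j}"
      by blast
    also have "\<dots> \<in> sets (sample_law n (data_law d))"
    proof (rule sets.sets_Collect_finite_All)
      fix j assume "j \<in> {..<n}"
      then have "j < n" by simp
      from measurable_compose[OF measurable_sample[OF this] measurable_label[OF d]]
      have "(\<lambda>S. label d (S j)) \<in> sample_law n (data_law d) \<rightarrow>\<^sub>M count_space UNIV" .
      from measurable_sets[OF this, of "{xs ! j}"]
      show "{S \<in> space (sample_law n (data_law d)). label d (S j) = xs ! j} \<in> sets (sample_law n (data_law d))"
        by (simp add: vimage_def Int_def conj_commute)
    qed simp
    finally show "code -` {xs} \<inter> space (sample_law n (data_law d)) \<in> sets (sample_law n (data_law d))" .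
  qed auto
  have "pick \<in> count_space (range code) \<rightarrow>\<^sub>M borel_Rd d"
  proof -
    have "pick xs \<in> Rd d" if "xs \<in> range code" for xs
    proof -
      obtain S where "xs = code S" using \<open>xs \<in> range code\<close> by blast
      then show ?thesis
        using pick[of S] by (simp add: emp_minimizer_def is_arg_min_def unit_ball_Rd)
    qed
    then show ?thesis by (simp add: space_borel_Rd)
  qed
  from measurable_compose[OF code this]
  have "(\<lambda>S. pick (code S)) \<in> minimizer_choices d (unit_ball d) (loss d) (data_law d) n"
    using pick by (simp add: minimizer_choices_def)
  then show ?thesis by blast
qed

section \<open>Bounds and limit of the generalization error\<close>

text \<open>For fixed \<open>S\<close>, integrating over the fresh point \<open>z\<close> replaces
  each weight by its mean. As \<open>ws S\<close> lies on the sphere, the result is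
  \<open>(1 + slope d) / 4\<close> minus the empirical quadratic part, which lies between 0 and
  \<open>1 / d\<close>.\<close>

lemma gap_bounds:
  assumes d: "4 \<le> d" "n \<le> half_size d" and n: "1 \<le> n"
    and ws: "ws \<in> minimizer_choices d (unit_ball d) (loss d) (data_law d) n"
  defines "I \<equiv> \<integral>(z, S). loss d (ws S) z - emp_loss (loss d) n S (ws S)
      \<partial>(data_law d \<Otimes>\<^sub>M sample_law n (data_law d))"
  shows "(1 + slope d) / 4 - 1 / d \<le> I" "I \<le> (1 + slope d) / 4"
proof -
  have d1: "1 \<le> d" using d by simp
  interpret D: prob_space "data_law d" by (rule prob_space_data_law)
  interpret S: prob_space "sample_law n (data_law d)" by (rule prob_space_sample_law)
  interpret P: pair_prob_space "data_law d" "sample_law n (data_law d)" ..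
  have wsm: "ws \<in> sample_law n (data_law d) \<rightarrow>\<^sub>M borel_Rd d"
    using ws by (simp add: minimizer_choices_def)
  have min: "emp_minimizer (unit_ball d) (loss d) n S (ws S)"
    if "S \<in> space (sample_law n (data_law d))" for S
    using ws that by (simp add: minimizer_choices_def)
  define h where "h S = (\<Sum>i<d. ((1 + slope d) / 2 - avg_weight d n S i) * (ws S i)\<^sup>2) / 2" for S
  have inner: "(\<integral>z. loss d (ws S) z - emp_loss (loss d) n S (ws S) \<partial>data_law d) = h S" for S
    unfolding loss_diff_emp_loss[OF n] h_def
    using integrable_label[OF d1]
    by (simp add: integral_weight[OF d1] D.prob_space)
  have h: "(1 + slope d) / 4 - 1 / d \<le> h S" "h S \<le> (1 + slope d) / 4"
    if S: "S \<in> space (sample_law n (data_law d))" for S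
  proof -
    have "(\<Sum>i<d. (1 + slope d) / 2 * (ws S i)\<^sup>2) = (1 + slope d) / 2 * (\<Sum>i<d. (ws S i)\<^sup>2)"
      by (rule sum_distrib_left[symmetric])
    then have eq: "h S = (1 + slope d) / 4 - (\<Sum>i<d. avg_weight d n S i * (ws S i)\<^sup>2) / 2"
      unfolding h_def left_diff_distrib sum_subtractf emp_minimizer_overfits(1)[OF d n min[OF S]] by (simp add: diff_divide_distrib)
    have "0 \<le> (\<Sum>i<d. avg_weight d n S i * (ws S i)\<^sup>2)"
      using avg_weight_bounds(1)[OF d1 n] by (intro sum_nonneg) (simp add: less_imp_le)
    then show "(1 + slope d) / 4 - 1 / d \<le> h S" "h S \<le> (1 + slope d) / 4"
      using emp_minimizer_overfits(2)[OF d n min[OF S]] unfolding eq by linarith+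
  qed
  have int: "integrable (data_law d \<Otimes>\<^sub>M sample_law n (data_law d))
      (\<lambda>(z, S). loss d (ws S) z - emp_loss (loss d) n S (ws S))"
  \<comment> \<open>Each of the \<open>d\<close> summands of the difference has absolute value at
    most 1.\<close>
  proof (rule P.integrable_const_bound[where B = "real d"])
    have "\<bar>loss d (ws S) z - emp_loss (loss d) n S (ws S)\<bar> \<le> real d"
      if "S \<in> space (sample_law n (data_law d))" for z S
    proof -
      have "\<bar>(weight d i (label d z) - avg_weight d n S i) * (ws S i)\<^sup>2\<bar> \<le> 1 * 1" if "i < d" for i
      proof -
        have "\<bar>weight d i (label d z) - avg_weight d n S i\<bar> \<le> 1"
          using weight_bounds[OF d1, of i "label d z"] avg_weight_bounds[OF d1 n, of S i] by linarith
        moreover have "(ws S i)\<^sup>2 \<le> 1"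
          using unit_ball_coord[of "ws S" d i] min[OF \<open>S \<in> _\<close>] \<open>i < d\<close>
          by (simp add: emp_minimizer_def is_arg_min_def abs_square_le_1)
        ultimately show ?thesis unfolding abs_mult by (intro mult_mono) auto
      qed
      then have "(\<Sum>i<d. \<bar>(weight d i (label d z) - avg_weight d n S i) * (ws S i)\<^sup>2\<bar>) \<le> (\<Sum>i<d. 1)"
        by (intro sum_mono) simp
      then have "\<bar>\<Sum>i<d. (weight d i (label d z) - avg_weight d n S i) * (ws S i)\<^sup>2\<bar> \<le> (\<Sum>i<d. 1)"
        by (rule order_trans[OF sum_abs])
      then show ?thesis
        unfolding loss_diff_emp_loss[OF n] sum_constant card_lessThan mult_1_right by linarith
    qed
    then show "AE x in data_law d \<Otimes>\<^sub>M sample_law n (data_law d).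
        norm (case x of (z, S) \<Rightarrow> loss d (ws S) z - emp_loss (loss d) n S (ws S)) \<le> real d"
      by (intro AE_I2) (auto simp: space_pair_measure)
    have lm: "(\<lambda>x. loss d (f x) (g x)) \<in> borel_measurable M"
      if "f \<in> M \<rightarrow>\<^sub>M borel_Rd d" "g \<in> M \<rightarrow>\<^sub>M borel_Rd d" for f g and M :: "(vect \<times> (nat \<Rightarrow> vect)) measure"
      using measurable_compose[OF measurable_Pair[OF that] measurable_loss[OF d1]] by simp
    show "(\<lambda>(z, S). loss d (ws S) z - emp_loss (loss d) n S (ws S))
        \<in> borel_measurable (data_law d \<Otimes>\<^sub>M sample_law n (data_law d))"
      unfolding split_beta' emp_loss_def
      by (intro borel_measurable_diff borel_measurable_divide borel_measurable_sum
          borel_measurable_const lm measurable_compose[OF measurable_snd]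
          measurable_compose[OF measurable_fst] wsm measurable_sample) (auto simp: sets_data_law)
  qed
  \<comment> \<open>Fubini's theorem, with the fresh point integrated first.\<close>
  have I: "I = (\<integral>S. h S \<partial>sample_law n (data_law d))"
    unfolding I_def using P.integral_snd[OF int] inner by simp
  have hint: "integrable (sample_law n (data_law d)) h"
    using P.integrable_snd[OF int] inner by simp
  show "(1 + slope d) / 4 - 1 / d \<le> I"
    unfolding I using S.integral_ge_const[OF hint] h by blast
  show "I \<le> (1 + slope d) / 4"
    unfolding I using S.integral_le_const[OF hint] h by blast
qed

text \<open>The lower bound needs one measurable choice of minimizers, since a supremum over no
  choices would be negative infinity; the upper bound holds for every choice.\<close>

lemma gen_error_bounds:
  assumes d: "4 \<le> d" "n \<le> half_size d" and n: "1 \<le> n"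
  shows "ereal ((1 + slope d) / 4 - 1 / d) \<le> gen_error d (unit_ball d) (loss d) (data_law d) n"
    and "gen_error d (unit_ball d) (loss d) (data_law d) n \<le> ereal ((1 + slope d) / 4)"
proof -
  obtain ws where ws: "ws \<in> minimizer_choices d (unit_ball d) (loss d) (data_law d) n"
    using minimizer_choices_nonempty[of d n] d n by auto
  show "ereal ((1 + slope d) / 4 - 1 / d) \<le> gen_error d (unit_ball d) (loss d) (data_law d) n"
    unfolding gen_error_def using gap_bounds(1)[OF d n ws] by (intro SUP_upper2[OF ws]) simp
  show "gen_error d (unit_ball d) (loss d) (data_law d) n \<le> ereal ((1 + slope d) / 4)"
    unfolding gen_error_def using gap_bounds(2)[OF d n] by (intro SUP_least) simp
qed

lemma gen_error_tendsto:
  assumes n: "1 \<le> n"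
  shows "(\<lambda>d. gen_error d (unit_ball d) (loss d) (data_law d) n) \<longlonglongrightarrow> ereal (1 / 4)"
proof (rule tendsto_sandwich)
  \<comment> \<open>With \<open>n\<close> fixed, \<open>4 ^ n <= d\<close> already yields
    \<open>n <= half_size d\<close>.\<close>
  have ev: "\<forall>\<^sub>F d in sequentially. 4 \<le> d \<and> n \<le> half_size d"
    using half_size_ge by (intro eventually_sequentiallyI[of "max 4 (4 ^ n)"]) auto
  show "\<forall>\<^sub>F d in sequentially. ereal ((1 + slope d) / 4 - 1 / d)
      \<le> gen_error d (unit_ball d) (loss d) (data_law d) n"
    using ev by eventually_elim (use gen_error_bounds(1)[OF _ _ n] in blast)
  show "\<forall>\<^sub>F d in sequentially. gen_error d (unit_ball d) (loss d) (data_law d) n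
      \<le> ereal ((1 + slope d) / 4)"
    using ev by eventually_elim (use gen_error_bounds(2)[OF _ _ n] in blast)
  have inv: "(\<lambda>d. 1 / real d) \<longlonglongrightarrow> 0" by (rule lim_1_over_n)
  then have "(\<lambda>d. (1 / real d)\<^sup>2) \<longlonglongrightarrow> 0\<^sup>2" by (rule tendsto_power)
  then have sl: "slope \<longlonglongrightarrow> 0" by (simp add: slope_def[abs_def] power_one_over)
  have "(\<lambda>d. (1 + slope d) / 4 - 1 / real d) \<longlonglongrightarrow> (1 + 0) / 4 - 0"
    by (intro tendsto_intros sl inv) simp
  then show "(\<lambda>d. ereal ((1 + slope d) / 4 - 1 / d)) \<longlonglongrightarrow> ereal (1 / 4)" by simp
  have "(\<lambda>d. (1 + slope d) / 4) \<longlonglongrightarrow> (1 + 0) / 4"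
    by (intro tendsto_intros sl) simp
  then show "(\<lambda>d. ereal ((1 + slope d) / 4)) \<longlonglongrightarrow> ereal (1 / 4)" by simp
qed

section \<open>Verification of all requirements on the example\<close>

lemma integrable_loss:
  assumes "1 \<le> d" shows "integrable (data_law d) (loss d w)"
  using integrable_label[OF assms, of "\<lambda>b. quad d (\<lambda>i. weight d i b) (slope d) w"]
  by (simp add: loss_def[abs_def])

theorem proposition13:
  shows "\<exists>(R::real) (W :: nat \<Rightarrow> vect set) (f :: nat \<Rightarrow> vect \<Rightarrow> vect \<Rightarrow> real) (D :: nat \<Rightarrow> vect measure).
    R > 0 \<and>
    (\<forall>d\<ge>1.
       W d \<subseteq> Rd d \<and> W d \<noteq> {} \<and> compactin (top_Rd d) (W d) \<and> convex_Rd d (W d) \<and>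
       (\<forall>w\<in>W d. norm_Rd d w \<le> R) \<and>
       prob_space (D d) \<and> sets (D d) = sets (borel_Rd d) \<and>
       (\<lambda>(w, z). f d w z) \<in> borel_measurable (borel_Rd d \<Otimes>\<^sub>M borel_Rd d) \<and>
       (\<forall>w\<in>W d. integrable (D d) (\<lambda>z. f d w z)) \<and>
       (\<forall>z\<in>Rd d.
          convex_on_Rd d (W d) (\<lambda>w. f d w z) \<and>
          smooth_Rd 1 d (\<lambda>w. f d w z) \<and>
          (SUP w\<in>W d. ereal (norm_Rd d (gradient d (\<lambda>w. f d w z) w))) \<le> 2)) \<and>
    (\<forall>n\<ge>1.
       (\<lambda>d. measure (sample_law n (D d))
              {S \<in> space (sample_law n (D d)). \<exists>!w. emp_minimizer (W d) (f d) n S w})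
         \<longlonglongrightarrow> 1 \<and>
       (\<exists>L::real. (\<lambda>d. gen_error d (W d) (f d) (D d) n) \<longlonglongrightarrow> ereal L \<and> L \<ge> 1 / 8))"
proof (rule exI[of _ 1], rule exI[of _ unit_ball], rule exI[of _ loss], rule exI[of _ data_law],
    intro conjI allI impI ballI)
  fix d :: nat and z assume d: "1 \<le> d"
  have w: "0 \<le> weight d i b \<and> weight d i b \<le> 1" for i b
    using weight_bounds[OF d] by (simp add: less_imp_le)
  show "convex_on_Rd d (unit_ball d) (\<lambda>w. loss d w z)"
    unfolding loss_def by (rule convex_on_quad) (simp add: w)
  show "smooth_Rd 1 d (\<lambda>w. loss d w z)"
    unfolding loss_def by (rule smooth_quad) (simp add: w)
  \<comment> \<open>Since \<open>d * slope d\<close> equals \<open>1 / d\<close>, the gradient bound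
    \<open>1 + d * slope d\<close> is at most 2.\<close>
  have "1 / real d \<le> 1" using d by simp
  moreover have "norm_Rd d (gradient d (\<lambda>w. loss d w z) v) \<le> 1 + d * slope d"
    if "v \<in> unit_ball d" for v
    unfolding loss_def using w slope_pos[OF d] that by (intro norm_gradient_quad_le) auto
  ultimately have "norm_Rd d (gradient d (\<lambda>w. loss d w z) v) \<le> 2" if "v \<in> unit_ball d" for v
    using that unfolding dim_times_slope by fastforce
  then show "(SUP w\<in>unit_ball d. ereal (norm_Rd d (gradient d (\<lambda>w. loss d w z) w))) \<le> 2"
    by (intro SUP_least) simp
next
  fix n :: nat assume n: "1 \<le> n"
  \<comment> \<open>Uniqueness holds for every data set, so the event is the whole space and its
    probability is 1 for each \<open>d >= 1\<close>.\<close>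
  have "\<forall>\<^sub>F d in sequentially. measure (sample_law n (data_law d))
      {S \<in> space (sample_law n (data_law d)). \<exists>!w. emp_minimizer (unit_ball d) (loss d) n S w} = 1"
  proof (rule eventually_sequentiallyI)
    fix d :: nat assume "1 \<le> d"
    then show "measure (sample_law n (data_law d))
      {S \<in> space (sample_law n (data_law d)). \<exists>!w. emp_minimizer (unit_ball d) (loss d) n S w} = 1"
      using ex1_emp_minimizer[of d n] n prob_space.prob_space[OF prob_space_sample_law[of n d]] by simp
  qed
  then show "(\<lambda>d. measure (sample_law n (data_law d))
      {S \<in> space (sample_law n (data_law d)). \<exists>!w. emp_minimizer (unit_ball d) (loss d) n S w}) \<longlonglongrightarrow> 1"
    by (rule tendsto_eventually)
  show "\<exists>L::real. (\<lambda>d. gen_error d (unit_ball d) (loss d) (data_law d) n) \<longlonglongrightarrow> ereal L \<and> L \<ge> 1 / 8"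
    using gen_error_tendsto[OF n] by (intro exI[of _ "1/4"]) simp
next
  fix d :: nat assume d: "1 \<le> d"
  show "(\<lambda>(w, z). loss d w z) \<in> borel_measurable (borel_Rd d \<Otimes>\<^sub>M borel_Rd d)"
    by (rule measurable_loss[OF d])
  show "integrable (data_law d) (\<lambda>z. loss d w z)" for w
    by (rule integrable_loss[OF d])
  show "unit_ball d \<noteq> {}" using zero_in_unit_ball by blast
qed (simp_all add: unit_ball_Rd subsetI norm_le_one
    compactin_unit_ball convex_unit_ball prob_space_data_law sets_data_law)

end
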